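(* Let $q$ be a complex number with $|q|<1$ and let $x$ and $y$ be complex numbers. Then \[ \sum_{j,\,k,\,\ell\,\geq0}\frac{(x^2y^2;q^2)_kx^jy^{2j+2\ell}}{(q;q)_j(q^2;q^2)_k(q^2;q^2)_{\ell}} (-1)^{j+k}q^{(j+k+\ell)(j+k+\ell-1)+\ell^2+k} =\frac{(q;q^2)_{\infty}}{2}\big\{(xy,-y;q)_{\infty}+(-xy,y;q)_{\infty}\big\}. \]
   Context: For complex $a$ and $|q|<1$, $(a;q)_\infty=\prod_{i=0}^{\infty}(1-aq^i)$, $(a;q)_n=(a;q)_\infty/(aq^n;q)_\infty$ for nonnegative integers $n$, and $(a_1,\dots,a_r;q)_n=(a_1;q)_n\cdots(a_r;q)_n$ (also for $n=\infty$). *)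

theory Defs
  imports "HOL-Analysis.Analysis"
begin

definition qpoch_inf :: "complex \<Rightarrow> complex \<Rightarrow> complex" where
  "qpoch_inf a q = (\<Prod>i. 1 - a * q ^ i)"

text \<open>
  The quotient \<open>(a;q)\<^sub>\<infinity> / (a q\<^sup>n;q)\<^sub>\<infinity>\<close> is \<open>0 / 0\<close> whenever \<open>a q\<^sup>m = 1\<close> for some \<open>m \<ge> n\<close>. As usual,
  \<open>(a;q)\<^sub>n\<close> then stands for the finite product to which the quotient reduces
  everywhere else (see \<open>qpoch_eq_quotient\<close> below).
\<close>
definition qpoch :: "complex \<Rightarrow> complex \<Rightarrow> nat \<Rightarrow> complex" where
  "qpoch a q n = (\<Prod>i<n. 1 - a * q ^ i)"

lemma convergent_prod_qpoch:
  fixes a q :: complex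
  assumes "norm q < 1"
  shows "convergent_prod (\<lambda>i. 1 - a * q ^ i)"
proof -
  have "summable (\<lambda>i. norm a * norm q ^ i)"
    using assms by (intro summable_mult summable_geometric) simp
  then have "abs_convergent_prod (\<lambda>i. 1 - a * q ^ i)"
    by (intro summable_imp_abs_convergent_prod) (simp add: norm_mult norm_power)
  then show ?thesis
    by (rule abs_convergent_prod_imp_convergent_prod)
qed

lemma qpoch_mult_qpoch_inf:
  assumes "norm q < 1"
  shows "qpoch a q n * qpoch_inf (a * q ^ n) q = qpoch_inf a q"
  using has_prod_ignore_initial_segment'[OF convergent_prod_qpoch[OF assms, of a], of n]
  by (simp add: has_prod_iff qpoch_def qpoch_inf_def power_add mult_ac)

lemma qpoch_eq_quotient:
  assumes "norm q < 1" and "\<And>i. a * q ^ (n + i) \<noteq> 1"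
  shows "qpoch a q n = qpoch_inf a q / qpoch_inf (a * q ^ n) q"
proof -
  have "1 - a * q ^ n * q ^ i \<noteq> 0" for i
    using assms(2)[of i] by (simp add: power_add mult.assoc)
  then have "qpoch_inf (a * q ^ n) q \<noteq> 0"
    unfolding qpoch_inf_def by (intro prodinf_nonzero convergent_prod_qpoch assms)
  then show ?thesis
    using qpoch_mult_qpoch_inf[OF assms(1), of a n] by (simp add: field_simps)
qed

end

(* Write w = x y and p = q^2. Expanding (w^2;p)_k by the q-binomial theorem, k = r + s, gives an
   absolutely convergent fourfold series in j, l, r, s. Euler's series evaluates the sum over s as
   (q;p)_inf / (q;p)_(j+l+r). The coefficient of y^m w^i is then a finite sum over j + 2l = m and
   j + 2r = i, which a q-analogue of the expansion of (1 + 2z + z^2)^T = (1 + z)^(2T) evaluates as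
   (q;p)_inf (-1)^i q^(C(m,2) + C(i,2)) / ((q;q)_m (q;q)_i) for m + i even. On the right-hand side,
   Euler's series for the four products gives the same coefficients, and the two summands cancel
   when m + i is odd. *)
theory Submission
  imports Defs
begin

section \<open>Finite q-Pochhammer symbols\<close>

lemma qpoch_0 [simp]: "qpoch a q 0 = 1"
  by (simp add: qpoch_def)

lemma qpoch_Suc: "qpoch a q (Suc n) = qpoch a q n * (1 - a * q ^ n)"
  by (simp add: qpoch_def)

lemma qpoch_nonzero:
  assumes "norm q < 1" "norm a < 1"
  shows "qpoch a q n \<noteq> 0"
proof -
  have "norm (a * q ^ i) < 1" for i
  proof -
    have "norm a * norm q ^ i \<le> norm a * 1"
      using assms by (intro mult_left_mono power_le_one) auto
    then show ?thesis using assms by (simp add: norm_mult norm_power)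
  qed
  then have "1 - a * q ^ i \<noteq> 0" for i
    by (metis norm_one order_less_irrefl right_minus_eq)
  then show ?thesis by (simp add: qpoch_def)
qed

text \<open>Each factor has norm at least 1 - c because |a q^i| <= |a| <= c. In the convergence
  proofs a denominator therefore costs at most a geometric factor.\<close>

lemma norm_qpoch_ge:
  assumes "norm q < 1" "norm a \<le> c" "c \<le> 1"
  shows "(1 - c) ^ n \<le> norm (qpoch a q n)"
proof -
  have "1 - c \<le> norm (1 - a * q ^ i)" for i
  proof -
    have "norm a * norm q ^ i \<le> norm a * 1"
      using assms by (intro mult_left_mono power_le_one) auto
    then have "norm (a * q ^ i) \<le> c" using assms by (simp add: norm_mult norm_power)
    moreover have "1 - norm (a * q ^ i) \<le> norm (1 - a * q ^ i)"
      by (metis norm_one norm_triangle_ineq2)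
    ultimately show ?thesis by linarith
  qed
  then have "(\<Prod>i<n. 1 - c) \<le> (\<Prod>i<n. norm (1 - a * q ^ i))"
    using assms by (intro prod_mono) auto
  then show ?thesis by (simp add: qpoch_def flip: prod_norm)
qed

text \<open>The 2n factors 1 - q^i of (q;q)_(2n) separate into odd exponents, giving base q^2
  started at q, and even exponents, giving base q^2 started at q^2.\<close>

lemma qpoch_double: "qpoch q q (2 * n) = qpoch q (q^2) n * qpoch (q^2) (q^2) n"
  by (induction n) (simp_all add: qpoch_Suc power_mult power2_eq_square algebra_simps flip: power_mult_distrib)

section \<open>Arithmetic of the exponents n choose 2\<close>

lemma choose_two_Suc: "Suc n choose 2 = (n choose 2) + n"
  by (simp add: numeral_2_eq_2)

lemma choose_two_add: "(a + b) choose 2 = (a choose 2) + (b choose 2) + a * b"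
  by (induction b) (simp_all add: choose_two_Suc)

lemma twice_choose_two_add: "2 * (n choose 2) + n = n^2"
  by (induction n) (auto simp: choose_two_Suc power2_eq_square algebra_simps)

lemma twice_choose_two: "n * (n - 1) = 2 * (n choose 2)"
  using twice_choose_two_add[of n] by (simp add: power2_eq_square diff_mult_distrib2)

section \<open>Absolute convergence and Euler's series\<close>

text \<open>Consecutive terms have ratio b c^n, which tends to 0, so a quadratic exponent beats
  every geometric factor. These series are the majorants used below.\<close>

lemma summable_quadratic_power:
  fixes b c :: real
  assumes "0 \<le> b" "0 \<le> c" "c < 1"
  shows "summable (\<lambda>n. b ^ n * c ^ (n choose 2))"
proof -
  have "(\<lambda>n. b * c ^ n) \<longlonglongrightarrow> b * 0"
    using assms by (intro tendsto_mult tendsto_const LIMSEQ_power_zero) auto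
  then have "eventually (\<lambda>n. b * c ^ n < 1/2) sequentially"
    by (rule order_tendstoD) simp
  then obtain N where N: "\<And>n. n \<ge> N \<Longrightarrow> b * c ^ n < 1/2"
    by (auto simp: eventually_sequentially)
  show ?thesis
  proof (rule summable_ratio_test[of "1/2" N])
    fix n assume "n \<ge> N"
    have "b ^ Suc n * c ^ (Suc n choose 2) = (b * c ^ n) * (b ^ n * c ^ (n choose 2))"
      by (simp add: choose_two_Suc power_add algebra_simps)
    also have "\<dots> \<le> 1/2 * (b ^ n * c ^ (n choose 2))"
      using N[OF \<open>n \<ge> N\<close>] assms by (intro mult_right_mono) auto
    finally show "norm (b ^ Suc n * c ^ (Suc n choose 2)) \<le> 1/2 * norm (b ^ n * c ^ (n choose 2))"
      using assms by simp
  qed simp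
qed

text \<open>Dividing by (q;q)_n costs at most (1 - |q|)^(-n), and the quadratic power of q absorbs
  this together with z^n, for every z.\<close>

lemma abs_summable_euler:
  fixes q z :: complex
  assumes "norm q < 1"
  shows "(\<lambda>n. norm ((-1)^n * q ^ (n choose 2) / qpoch q q n * z ^ n)) summable_on UNIV"
    and "summable (\<lambda>n. norm ((-1)^n * q ^ (n choose 2) / qpoch q q n * z ^ n))"
proof -
  have "norm ((-1)^n * q ^ (n choose 2) / qpoch q q n * z ^ n)
      \<le> (norm z / (1 - norm q)) ^ n * norm q ^ (n choose 2)" for n
  proof -
    have "norm ((-1)^n * q ^ (n choose 2) / qpoch q q n * z ^ n)
        = norm z ^ n * norm q ^ (n choose 2) / norm (qpoch q q n)"
      by (simp add: norm_mult norm_divide norm_power)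
    also have "\<dots> \<le> norm z ^ n * norm q ^ (n choose 2) / (1 - norm q) ^ n"
      using assms by (intro divide_left_mono norm_qpoch_ge mult_pos_pos) (auto simp: qpoch_nonzero)
    finally show ?thesis by (simp add: power_divide)
  qed
  moreover have "summable (\<lambda>n. (norm z / (1 - norm q)) ^ n * norm q ^ (n choose 2))"
    using assms by (intro summable_quadratic_power) auto
  ultimately show *: "summable (\<lambda>n. norm ((-1)^n * q ^ (n choose 2) / qpoch q q n * z ^ n))"
    by (intro summable_norm_comparison_test[OF exI[of _ 0]]) auto
  show "(\<lambda>n. norm ((-1)^n * q ^ (n choose 2) / qpoch q q n * z ^ n)) summable_on UNIV"
    by (subst summable_on_UNIV_nonneg_real_iff[OF norm_ge_zero]) (rule *)
qed

text \<open>The series \<open>G\<close> satisfies \<open>G z = (1 - z) * G (q * z)\<close>, and iterating this towards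
  \<open>G 0 = 1\<close> produces the infinite product.\<close>
lemma euler_has_sum:
  fixes q z :: complex
  assumes q: "norm q < 1"
  shows "((\<lambda>n. (-1)^n * q ^ (n choose 2) / qpoch q q n * z ^ n) has_sum qpoch_inf z q) UNIV"
proof -
  define c where "c = (\<lambda>n. (-1)^n * q ^ (n choose 2) / qpoch q q n)"
  define G where "G = (\<lambda>z. \<Sum>n. c n * z ^ n)"
  have summ: "summable (\<lambda>n. c n * z ^ n)" for z
    unfolding c_def using abs_summable_euler(2)[OF q] by (rule summable_norm_cancel)
  \<comment> \<open>Coefficient form of the functional equation: the power z^(n+1) in G z - G (q z)
    against the same power in -z G (q z).\<close>
  have cS: "c (Suc n) * (1 - q ^ Suc n) = - (c n * q ^ n)" for n
  proof -
    have nz: "qpoch q q (Suc n) \<noteq> 0" by (intro qpoch_nonzero q)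
    then have "1 - q * q ^ n \<noteq> 0" "qpoch q q n \<noteq> 0" by (auto simp: qpoch_Suc)
    then show ?thesis
      by (simp add: c_def qpoch_Suc choose_two_Suc power_add)
  qed
  have step: "G z = (1 - z) * G (q * z)" for z
  proof -
    have "G z - G (q * z) = (\<Sum>n. c n * z ^ n - c n * (q * z) ^ n)"
      unfolding G_def by (rule suminf_diff[OF summ summ])
    also have "\<dots> = (\<Sum>n. c (Suc n) * z ^ Suc n - c (Suc n) * (q * z) ^ Suc n)"
      by (subst suminf_split_head[OF summable_diff[OF summ summ]]) simp
    also have "\<dots> = (\<Sum>n. - z * (c n * (q * z) ^ n))"
    proof (rule suminf_cong)
      fix n
      have "c (Suc n) * z ^ Suc n - c (Suc n) * (q * z) ^ Suc n
          = (c (Suc n) * (1 - q ^ Suc n)) * z ^ Suc n"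
        by (simp add: power_mult_distrib algebra_simps)
      also have "\<dots> = - z * (c n * (q * z) ^ n)"
        unfolding cS by (simp add: power_mult_distrib)
      finally show "c (Suc n) * z ^ Suc n - c (Suc n) * (q * z) ^ Suc n = - z * (c n * (q * z) ^ n)" .
    qed
    also have "\<dots> = - z * G (q * z)"
      unfolding G_def by (rule suminf_mult[OF summ])
    finally show ?thesis by (simp add: algebra_simps)
  qed
  have iter: "G z = qpoch z q n * G (z * q ^ n)" for n
  proof (induction n)
    case (Suc n)
    show ?case
      using step[of "z * q ^ n"] by (simp add: Suc qpoch_Suc mult_ac)
  qed simp
  have "isCont G 0"
    unfolding G_def by (rule isCont_powser_converges_everywhere[OF summ])
  moreover have "(\<lambda>n. z * q ^ n) \<longlonglongrightarrow> z * 0"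
    using q by (intro tendsto_mult tendsto_const LIMSEQ_power_zero)
  ultimately have "(\<lambda>n. G (z * q ^ n)) \<longlonglongrightarrow> G 0"
    using isCont_tendsto_compose by force
  moreover have "G 0 = 1"
    unfolding G_def powser_zero by (simp add: c_def numeral_2_eq_2)
  moreover have "(\<lambda>n. qpoch z q n) \<longlonglongrightarrow> qpoch_inf z q"
    using convergent_prod_LIMSEQ[OF convergent_prod_qpoch[OF q, of z]]
    unfolding qpoch_def qpoch_inf_def by (subst LIMSEQ_lessThan_iff_atMost)
  ultimately have "(\<lambda>n. qpoch z q n * G (z * q ^ n)) \<longlonglongrightarrow> qpoch_inf z q * 1"
    by (intro tendsto_mult) auto
  then have "G z = qpoch_inf z q"
    using LIMSEQ_unique[OF tendsto_const] by (simp flip: iter)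
  moreover have "(\<lambda>n. c n * z ^ n) sums G z"
    unfolding G_def by (rule summable_sums[OF summ])
  ultimately show ?thesis
    using abs_summable_euler(2)[OF q, of z]
    by (intro norm_summable_imp_has_sum) (simp_all add: c_def)
qed

section \<open>The finite q-binomial theorem\<close>

text \<open>Induction on k through a q-Pascal rule. With p = q^2 this expansion introduces the index
  r of the fourfold series.\<close>

lemma qpoch_binomial:
  fixes p a :: complex
  assumes p: "norm p < 1"
  shows "qpoch a p k =
    (\<Sum>r\<le>k. qpoch p p k / (qpoch p p r * qpoch p p (k - r)) * (-1)^r * p ^ (r choose 2) * a ^ r)"
proof (induction k)
  case (Suc k)
  define h where "h = (\<lambda>n. inverse (qpoch p p n))"
  define u where "u = (\<lambda>r. (-1)^r * p ^ (r choose 2) * a ^ r :: complex)"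
  have nz: "qpoch p p n \<noteq> 0" for n by (intro qpoch_nonzero p)
  have nz': "1 - p * p ^ n \<noteq> 0" for n using nz[of "Suc n"] by (simp add: qpoch_Suc)
  have h: "h n = h (Suc n) * (1 - p * p ^ n)" for n
    using nz[of n] nz'[of n] by (simp add: h_def qpoch_Suc field_simps)
  have u: "u (Suc r) = - a * p ^ r * u r" for r
    by (simp add: u_def choose_two_Suc power_add)
  \<comment> \<open>The q-Pascal rule: 1 - p^(k+1) = (1 - p^(k+1-r)) + p^(k+1-r) (1 - p^r). The
    first part goes into \<open>A\<close>, the second into \<open>B\<close>.\<close>
  define A where "A = (\<lambda>r. qpoch p p k * h r * (1 - p ^ (Suc k - r)) * h (Suc k - r) * u r)"
  define B where "B = (\<lambda>r. qpoch p p k * (1 - p ^ r) * h r * p ^ (Suc k - r) * h (Suc k - r) * u r)"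
  have "(\<Sum>r\<le>Suc k. qpoch p p (Suc k) * h r * h (Suc k - r) * u r) = (\<Sum>r\<le>Suc k. A r + B r)"
  proof (rule sum.cong)
    fix r assume "r \<in> {..Suc k}"
    then have "p * p ^ k = p ^ (Suc k - r) * p ^ r" by (simp flip: power_add power_Suc)
    then show "qpoch p p (Suc k) * h r * h (Suc k - r) * u r = A r + B r"
      unfolding A_def B_def qpoch_Suc by (simp add: algebra_simps)
  qed simp
  also have "\<dots> = (\<Sum>r\<le>Suc k. A r) + (\<Sum>r\<le>Suc k. B r)" by (rule sum.distrib)
  \<comment> \<open>\<open>A\<close> vanishes at r = k + 1 because of its factor 1 - p^0;
    \<open>B\<close> vanishes at r = 0 for the same reason, which permits its index shift.\<close>
  also have "(\<Sum>r\<le>Suc k. A r) = (\<Sum>r\<le>k. A r)" by (simp add: A_def)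
  also have "\<dots> = (\<Sum>r\<le>k. qpoch p p k * h r * h (k - r) * u r)"
  proof (rule sum.cong)
    fix r assume "r \<in> {..k}"
    then show "A r = qpoch p p k * h r * h (k - r) * u r"
      using h[of "k - r"] by (simp add: A_def Suc_diff_le mult_ac)
  qed simp
  also have "(\<Sum>r\<le>Suc k. B r) = (\<Sum>r\<le>k. B (Suc r))"
    by (subst sum.atMost_Suc_shift) (simp add: B_def)
  \<comment> \<open>The power p^(k-r) in \<open>B (Suc r)\<close> and the p^r gained from
    \<open>u\<close> combine to p^k, so -a p^k leaves the sum and the new factor 1 - a p^k
    appears.\<close>
  also have "\<dots> = (\<Sum>r\<le>k. - a * p ^ k * (qpoch p p k * h r * h (k - r) * u r))"
  proof (rule sum.cong)
    fix r assume "r \<in> {..k}"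
    then have pk: "p ^ k = p ^ (k - r) * p ^ r" by (simp flip: power_add)
    show "B (Suc r) = - a * p ^ k * (qpoch p p k * h r * h (k - r) * u r)"
      using h[of r] by (simp add: B_def u pk mult_ac)
  qed simp
  also have "\<dots> = - a * p ^ k * (\<Sum>r\<le>k. qpoch p p k * h r * h (k - r) * u r)"
    by (rule sum_distrib_left[symmetric])
  also have "(\<Sum>r\<le>k. qpoch p p k * h r * h (k - r) * u r) = qpoch a p k"
    unfolding Suc.IH by (simp add: h_def u_def divide_inverse mult_ac)
  finally show ?case
    by (simp add: qpoch_Suc[of a] h_def u_def divide_inverse algebra_simps)
qed (simp add: numeral_2_eq_2)

section \<open>A q-analogue of (1 + 2z + z^2)^T = (1 + z)^(2T)\<close>

text \<open>Once s has been summed out, these triples are the ones that contribute to y^m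
  w^i.\<close>

definition fibre :: "nat \<Rightarrow> nat \<Rightarrow> (nat \<times> nat \<times> nat) set" where
  "fibre m i = {(j, l, r). j + 2 * l = m \<and> j + 2 * r = i}"

lemma finite_fibre [simp]: "finite (fibre m i)"
  by (rule finite_subset[of _ "{..m} \<times> {..m} \<times> {..i}"]) (auto simp: fibre_def)

text \<open>With T = j + l + r, the limit q -> 1 is 2^j T! / (j! l! r!): the contribution to (1 + 2z
  + z^2)^T from choosing 2z in j factors, z^2 in l and 1 in r.\<close>

definition qtrinomial :: "complex \<Rightarrow> nat \<Rightarrow> nat \<Rightarrow> nat \<Rightarrow> complex" where
  "qtrinomial q j l r = q ^ (2 * l * r) * qpoch (q^2) (q^2) (j + l + r)
     / (qpoch q q j * qpoch (q^2) (q^2) l * qpoch (q^2) (q^2) r)"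

lemma qpoch_Suc_factor_nonzero:
  fixes q :: complex
  assumes "norm q < 1"
  shows "1 - q * q ^ n \<noteq> 0"
  using qpoch_nonzero[of q q "Suc n"] assms by (auto simp: qpoch_Suc)

lemma norm_square_less_one: "norm q < 1 \<Longrightarrow> norm (q^2) < 1" for q :: complex
  by (simp add: norm_power power_less_one_iff)

text \<open>With \<open>m = j + 2 l\<close> and \<open>i = j + 2 r\<close>, this is term by term the recurrence
  \<open>[N, m] = q\<^sup>i [N-2, m-2] + (1 + q\<^sup>m) [N-2, m-1] + q\<^sup>2\<^sup>m [N-2, m]\<close> of the Gaussian binomial
  coefficients, \<open>N = m + i\<close>.\<close>
lemma qtrinomial_rec:
  assumes q: "norm q < 1" and pos: "j + l + r > 0"
  shows "qtrinomial q j l r =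
      q ^ (j + 2 * r) * (if l \<ge> 1 then qtrinomial q j (l - 1) r else 0)
    + (1 + q ^ (j + 2 * l)) * (if j \<ge> 1 then qtrinomial q (j - 1) l r else 0)
    + q ^ (2 * (j + 2 * l)) * (if r \<ge> 1 then qtrinomial q j l (r - 1) else 0)"
proof -
  define p where "p = q^2"
  define D where "D = qpoch q q j * qpoch p p l * qpoch p p r"
  obtain T where T: "j + l + r = Suc T" using pos by (metis Suc_pred)
  have p: "norm p < 1" unfolding p_def by (rule norm_square_less_one[OF q])
  note fq = qpoch_Suc_factor_nonzero[OF q] and fp = qpoch_Suc_factor_nonzero[OF p]
  \<comment> \<open>The three predecessors are put over the common denominator \<open>D\<close>. The
    factors 1 - p^l, 1 - q^j and 1 - p^r vanish at index 0, so the closed forms cover the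
    \<open>else\<close> branches too.\<close>
  have 1: "q ^ (j + 2 * r) * (if l \<ge> 1 then qtrinomial q j (l - 1) r else 0)
      = q ^ j * q ^ (2 * l * r) * (1 - p ^ l) * qpoch p p T / D"
  proof (cases l)
    case (Suc l')
    have [simp]: "j + l' + r = T" using T Suc by simp
    have e: "q ^ (j + 2 * r) * q ^ (2 * l' * r) = q ^ j * q ^ (2 * l * r)"
      by (simp add: Suc add.assoc flip: power_add)
    have d: "D = qpoch q q j * qpoch p p l' * qpoch p p r * (1 - p ^ l)"
      by (simp add: D_def Suc qpoch_Suc)
    have "1 - p ^ l \<noteq> 0" using fp[of l'] by (simp add: Suc)
    then show ?thesis
      unfolding d by (simp add: Suc qtrinomial_def e[unfolded Suc] flip: p_def mult.assoc)
  qed simp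
  have 2: "(if j \<ge> 1 then qtrinomial q (j - 1) l r else 0)
      = q ^ (2 * l * r) * (1 - q ^ j) * qpoch p p T / D"
  proof (cases j)
    case (Suc j')
    have [simp]: "j' + l + r = T" using T Suc by simp
    have d: "D = qpoch q q j' * qpoch p p l * qpoch p p r * (1 - q ^ j)"
      by (simp add: D_def Suc qpoch_Suc)
    have "1 - q ^ j \<noteq> 0" using fq[of j'] by (simp add: Suc)
    then show ?thesis
      unfolding d by (simp add: Suc qtrinomial_def flip: p_def)
  qed simp
  have 3: "q ^ (2 * (j + 2 * l)) * (if r \<ge> 1 then qtrinomial q j l (r - 1) else 0)
      = q ^ (2 * (j + l)) * q ^ (2 * l * r) * (1 - p ^ r) * qpoch p p T / D"
  proof (cases r)
    case (Suc r')
    have [simp]: "j + l + r' = T" using T Suc by simp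
    have e: "q ^ (2 * (j + 2 * l)) * q ^ (2 * l * r') = q ^ (2 * (j + l)) * q ^ (2 * l * r)"
      by (simp add: Suc algebra_simps flip: power_add)
    have d: "D = qpoch q q j * qpoch p p l * qpoch p p r' * (1 - p ^ r)"
      by (simp add: D_def Suc qpoch_Suc)
    have "1 - p ^ r \<noteq> 0" using fp[of r'] by (simp add: Suc)
    then show ?thesis
      unfolding d using e[unfolded Suc] by (simp add: Suc qtrinomial_def flip: p_def)
        (simp add: algebra_simps flip: power_add)
  qed simp
  \<comment> \<open>What remains after the common factor is removed. With p = q^2 the left side
    telescopes to 1 - q^(2(j+l+r)).\<close>
  have key: "q ^ j * (1 - p ^ l) + (1 + q ^ (j + 2 * l)) * (1 - q ^ j)
      + q ^ (2 * (j + l)) * (1 - p ^ r) = 1 - p * p ^ T"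
  proof -
    have "p * p ^ T = p ^ j * p ^ l * p ^ r" by (simp add: T flip: power_add power_Suc)
    moreover have "q ^ (2 * n) = p ^ n" "p ^ j = q ^ j * q ^ j" for n
      by (simp_all add: p_def power_mult power2_eq_square power_mult_distrib)
    ultimately show ?thesis by (simp add: power_add algebra_simps)
  qed
  have "qtrinomial q j l r = q ^ (2 * l * r) * (1 - p * p ^ T) * qpoch p p T / D"
    by (simp add: qtrinomial_def T D_def qpoch_Suc flip: p_def)
  also have "\<dots> = q ^ j * q ^ (2 * l * r) * (1 - p ^ l) * qpoch p p T / D
     + (1 + q ^ (j + 2 * l)) * (q ^ (2 * l * r) * (1 - q ^ j) * qpoch p p T / D)
     + q ^ (2 * (j + l)) * q ^ (2 * l * r) * (1 - p ^ r) * qpoch p p T / D"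
    unfolding key[symmetric] by (simp add: algebra_simps add_divide_distrib diff_divide_distrib)
  finally show ?thesis unfolding 1 2 3 .
qed

text \<open>Summed over a fibre, \<open>qtrinomial_rec\<close> becomes a two-step recurrence in m +
  i, and the Gaussian binomial coefficient satisfies the same one.\<close>

lemma sum_fibre_qtrinomial:
  assumes q: "norm q < 1" and "even (m + i)"
  shows "(\<Sum>(j, l, r)\<in>fibre m i. qtrinomial q j l r) = qpoch q q (m + i) / (qpoch q q m * qpoch q q i)"
  using assms(2)
proof (induction "m + i" arbitrary: m i rule: less_induct)
  case less
  define f where "f = (\<lambda>m i. \<Sum>(j, l, r)\<in>fibre m i. qtrinomial q j l r)"
  define h where "h = (\<lambda>n. inverse (qpoch q q n))"
  show ?case
  proof (cases "m + i = 0")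
    case True
    moreover have "fibre 0 0 = {(0, 0, 0)}" by (auto simp: fibre_def)
    ultimately show ?thesis by (simp add: qtrinomial_def)
  next
    case False
    \<comment> \<open>Evenness excludes m + i = 1, so the recurrence can always descend by
      two.\<close>
    then obtain N where N: "m + i = Suc (Suc N)"
      using less.prems by (metis even_Suc even_zero old.nat.exhaust)
    have nz: "qpoch q q n \<noteq> 0" for n by (intro qpoch_nonzero q)
    have h: "h n = h (Suc n) * (1 - q * q ^ n)" for n
      using nz[of n] qpoch_Suc_factor_nonzero[OF q, of n] by (simp add: h_def qpoch_Suc field_simps)
    have IH: "f m' i' = qpoch q q N * h m' * h i'" if "m' + i' = N" for m' i'
      using less.hyps[of m' i'] less.prems that N by (simp add: f_def h_def divide_inverse)
    \<comment> \<open>Lowering l, j or r by one is a bijection onto the fibre of (m-2, i), (m-1,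
      i-1) or (m, i-2). When m or i is too small, no triple has a positive index to lower.\<close>
    have 1: "(\<Sum>(j, l, r)\<in>fibre m i. if l \<ge> 1 then qtrinomial q j (l - 1) r else 0)
        = (if m \<ge> 2 then f (m - 2) i else 0)"
    proof -
      have "(\<Sum>(j, l, r)\<in>fibre m i. if l \<ge> 1 then qtrinomial q j (l - 1) r else 0)
         = (\<Sum>(j, l, r)\<in>{(j, l, r)\<in>fibre m i. l \<ge> 1}. qtrinomial q j (l - 1) r)"
        by (intro sum.mono_neutral_cong_right) (auto split: if_splits)
      also have "\<dots> = (\<Sum>(j, l, r)\<in>(if m \<ge> 2 then fibre (m - 2) i else {}). qtrinomial q j l r)"
        by (rule sum.reindex_bij_witness[of _ "\<lambda>(j, l, r). (j, l + 1, r)" "\<lambda>(j, l, r). (j, l - 1, r)"])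
           (auto simp: fibre_def split: if_splits)
      finally show ?thesis by (simp add: f_def)
    qed
    have 2: "(\<Sum>(j, l, r)\<in>fibre m i. if j \<ge> 1 then qtrinomial q (j - 1) l r else 0)
        = (if m \<ge> 1 \<and> i \<ge> 1 then f (m - 1) (i - 1) else 0)"
    proof -
      have "(\<Sum>(j, l, r)\<in>fibre m i. if j \<ge> 1 then qtrinomial q (j - 1) l r else 0)
         = (\<Sum>(j, l, r)\<in>{(j, l, r)\<in>fibre m i. j \<ge> 1}. qtrinomial q (j - 1) l r)"
        by (intro sum.mono_neutral_cong_right) (auto split: if_splits)
      also have "\<dots> = (\<Sum>(j, l, r)\<in>(if m \<ge> 1 \<and> i \<ge> 1 then fibre (m - 1) (i - 1) else {}). qtrinomial q j l r)"
        by (rule sum.reindex_bij_witness[of _ "\<lambda>(j, l, r). (j + 1, l, r)" "\<lambda>(j, l, r). (j - 1, l, r)"])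
           (auto simp: fibre_def split: if_splits)
      finally show ?thesis by (simp add: f_def)
    qed
    have 3: "(\<Sum>(j, l, r)\<in>fibre m i. if r \<ge> 1 then qtrinomial q j l (r - 1) else 0)
        = (if i \<ge> 2 then f m (i - 2) else 0)"
    proof -
      have "(\<Sum>(j, l, r)\<in>fibre m i. if r \<ge> 1 then qtrinomial q j l (r - 1) else 0)
         = (\<Sum>(j, l, r)\<in>{(j, l, r)\<in>fibre m i. r \<ge> 1}. qtrinomial q j l (r - 1))"
        by (intro sum.mono_neutral_cong_right) (auto split: if_splits)
      also have "\<dots> = (\<Sum>(j, l, r)\<in>(if i \<ge> 2 then fibre m (i - 2) else {}). qtrinomial q j l r)"
        by (rule sum.reindex_bij_witness[of _ "\<lambda>(j, l, r). (j, l, r + 1)" "\<lambda>(j, l, r). (j, l, r - 1)"])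
           (auto simp: fibre_def split: if_splits)
      finally show ?thesis by (simp add: f_def)
    qed
    have "f m i = (\<Sum>(j, l, r)\<in>fibre m i.
        q ^ i * (if l \<ge> 1 then qtrinomial q j (l - 1) r else 0)
      + (1 + q ^ m) * (if j \<ge> 1 then qtrinomial q (j - 1) l r else 0)
      + q ^ (2 * m) * (if r \<ge> 1 then qtrinomial q j l (r - 1) else 0))"
      unfolding f_def
    proof (intro sum.cong refl, clarify)
      fix j l r assume "(j, l, r) \<in> fibre m i"
      then have "m = j + 2 * l" "i = j + 2 * r" by (auto simp: fibre_def)
      moreover from this have "j + l + r > 0" using N by auto
      ultimately show "qtrinomial q j l r = q ^ i * (if l \<ge> 1 then qtrinomial q j (l - 1) r else 0)
        + (1 + q ^ m) * (if j \<ge> 1 then qtrinomial q (j - 1) l r else 0)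
        + q ^ (2 * m) * (if r \<ge> 1 then qtrinomial q j l (r - 1) else 0)"
        using qtrinomial_rec[OF q, of j l r] by simp
    qed
    also have "\<dots> = q ^ i * (if m \<ge> 2 then f (m - 2) i else 0)
        + (1 + q ^ m) * (if m \<ge> 1 \<and> i \<ge> 1 then f (m - 1) (i - 1) else 0)
        + q ^ (2 * m) * (if i \<ge> 2 then f m (i - 2) else 0)"
      unfolding 1[symmetric] 2[symmetric] 3[symmetric]
      by (simp add: case_prod_unfold sum.distrib sum_distrib_left)
    \<comment> \<open>The factors (1 - q^m) (1 - q^(m-1)) vanish at m = 0 and m = 1, so one formula
      includes the boundary despite truncated subtraction. The next two terms are treated
      alike.\<close>
    also have "(if m \<ge> 2 then f (m - 2) i else 0)
        = qpoch q q N * h m * h i * (1 - q ^ m) * (1 - q ^ (m - 1))"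
    proof (cases "m \<ge> 2")
      case True
      then obtain m' where m': "m = Suc (Suc m')" by (metis add_2_eq_Suc le_Suc_ex)
      then show ?thesis using IH[of m' i] N h[of m'] h[of "Suc m'"] by simp
    next
      case False
      then have "m = 0 \<or> m = 1" by auto
      then show ?thesis by auto
    qed
    also have "(if m \<ge> 1 \<and> i \<ge> 1 then f (m - 1) (i - 1) else 0)
        = qpoch q q N * h m * h i * (1 - q ^ m) * (1 - q ^ i)"
    proof (cases "m \<ge> 1 \<and> i \<ge> 1")
      case True
      then obtain m' i' where "m = Suc m'" "i = Suc i'" by (metis Suc_le_D One_nat_def)
      then show ?thesis using IH[of m' i'] N h[of m'] h[of i'] by simp
    next
      case False
      then have "m = 0 \<or> i = 0" by auto
      then show ?thesis by auto
    qed
    also have "(if i \<ge> 2 then f m (i - 2) else 0)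
        = qpoch q q N * h m * h i * (1 - q ^ i) * (1 - q ^ (i - 1))"
    proof (cases "i \<ge> 2")
      case True
      then obtain i' where i': "i = Suc (Suc i')" by (metis add_2_eq_Suc le_Suc_ex)
      then show ?thesis using IH[of m i'] N h[of i'] h[of "Suc i'"] by simp
    next
      case False
      then have "i = 0 \<or> i = 1" by auto
      then show ?thesis by auto
    qed
    also have "q ^ i * (qpoch q q N * h m * h i * (1 - q ^ m) * (1 - q ^ (m - 1)))
        + (1 + q ^ m) * (qpoch q q N * h m * h i * (1 - q ^ m) * (1 - q ^ i))
        + q ^ (2 * m) * (qpoch q q N * h m * h i * (1 - q ^ i) * (1 - q ^ (i - 1)))
      = qpoch q q N * h m * h i *
        (q ^ i * (1 - q ^ m) * (1 - q ^ (m - 1)) + (1 + q ^ m) * (1 - q ^ m) * (1 - q ^ i)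
          + q ^ (2 * m) * (1 - q ^ i) * (1 - q ^ (i - 1)))"
      by (simp add: algebra_simps)
    \<comment> \<open>The numerator identity of the Gaussian recurrence, with N + 2 = m + i. The
      cases m = 0 and i = 0 are separated because m - 1 and i - 1 truncate.\<close>
    also have "q ^ i * (1 - q ^ m) * (1 - q ^ (m - 1)) + (1 + q ^ m) * (1 - q ^ m) * (1 - q ^ i)
          + q ^ (2 * m) * (1 - q ^ i) * (1 - q ^ (i - 1)) = (1 - q * q ^ N) * (1 - q * q ^ Suc N)"
    proof (cases m)
      case 0
      then show ?thesis using N by (simp add: algebra_simps)
    next
      case (Suc m')
      show ?thesis
      proof (cases i)
        case 0
        then show ?thesis using N Suc by (simp add: algebra_simps mult_2 power_add)
      next
        case i: (Suc i')
        have "N = m' + i'" using N Suc i by simp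
        moreover have "q ^ (m' * 2) = q ^ m' * q ^ m'" by (simp add: mult_2_right power_add)
        ultimately show ?thesis unfolding Suc i by (simp add: algebra_simps power_add)
      qed
    qed
    finally show ?thesis
      unfolding f_def h_def N by (simp add: qpoch_Suc divide_inverse mult_ac)
  qed
qed

section \<open>Products of absolutely convergent series\<close>

lemma summable_on_product_nonneg:
  fixes f :: "'a \<Rightarrow> real" and g :: "'b \<Rightarrow> real"
  assumes "f summable_on UNIV" "g summable_on UNIV" "\<And>x. f x \<ge> 0" "\<And>y. g y \<ge> 0"
  shows "(\<lambda>(x, y). f x * g y) summable_on UNIV"
proof -
  have "(\<lambda>(x, y). f x * g y) summable_on (SIGMA x:UNIV. UNIV)"
  proof (rule summable_on_SigmaI)
    show "((\<lambda>y. case (x, y) of (x, y) \<Rightarrow> f x * g y) has_sum f x * infsum g UNIV) UNIV" for x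
      using assms(2) by (auto intro: has_sum_cmult_right)
    show "(\<lambda>x. f x * infsum g UNIV) summable_on UNIV"
      using assms(1) by (rule summable_on_cmult_left)
  qed (use assms in auto)
  then show ?thesis by simp
qed

text \<open>Absolute convergence provides the joint summability under which the iterated sum is the
  sum over pairs.\<close>

lemma has_sum_product_abs_summable:
  fixes f :: "'a \<Rightarrow> complex" and g :: "'b \<Rightarrow> complex"
  assumes "(f has_sum a) UNIV" "(g has_sum b) UNIV"
    and "(\<lambda>x. norm (f x)) summable_on UNIV" "(\<lambda>x. norm (g x)) summable_on UNIV"
  shows "((\<lambda>(x, y). f x * g y) has_sum a * b) UNIV"
proof -
  have "((\<lambda>(x, y). f x * g y) has_sum a * b) (SIGMA x:UNIV. UNIV)"
  proof (rule has_sum_SigmaI)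
    show "((\<lambda>y. case (x, y) of (x, y) \<Rightarrow> f x * g y) has_sum f x * b) UNIV" for x
      using assms(2) by (auto intro: has_sum_cmult_right)
    show "((\<lambda>x. f x * b) has_sum a * b) UNIV"
      using assms(1) by (rule has_sum_cmult_left)
    have "(\<lambda>(x, y). norm (f x) * norm (g y)) summable_on UNIV"
      using assms by (intro summable_on_product_nonneg) auto
    then have "(\<lambda>t. norm (case t of (x, y) \<Rightarrow> f x * g y)) summable_on UNIV"
      by (simp add: case_prod_unfold norm_mult)
    then show "(\<lambda>(x, y). f x * g y) summable_on (SIGMA x:UNIV. UNIV)"
      by (simp add: abs_summable_summable)
  qed
  then show ?thesis by simp
qed

section \<open>The fourfold series and its inner sums\<close>

text \<open>The terms of the series after the expansion of \<open>(w\<^sup>2;q\<^sup>2)\<^sub>k\<close> by the \<open>q\<close>-binomial theorem,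
  where \<open>w = x y\<close> and \<open>k = r + s\<close>.\<close>
definition quad_term :: "complex \<Rightarrow> complex \<Rightarrow> complex \<Rightarrow> nat \<Rightarrow> nat \<Rightarrow> nat \<Rightarrow> nat \<Rightarrow> complex" where
  "quad_term q w y j l r s =
     (-1) ^ (j + s) * w ^ (j + 2 * r) * y ^ (j + 2 * l)
       * q ^ (2 * ((j + l + r + s) choose 2) + l^2 + r^2 + s)
       / (qpoch q q j * qpoch (q^2) (q^2) l * qpoch (q^2) (q^2) r * qpoch (q^2) (q^2) s)"

text \<open>Keeping only the part of the exponent of q that separates the indices gives a majorant
  that is a product of four one-variable series.\<close>

lemma abs_summable_quad_term:
  assumes q: "norm q < 1"
  shows "(\<lambda>t. norm (case t of (j, l, r, s) \<Rightarrow> quad_term q w y j l r s)) summable_on UNIV"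
proof -
  define D where "D = inverse (1 - norm q)"
  define g where "g = (\<lambda>b n. b ^ n * (norm q ^ 2) ^ (n choose 2) :: real)"
  have D: "D \<ge> 0" using q by (simp add: D_def)
  have g0: "g b n \<ge> 0" if "b \<ge> 0" for b n using that by (simp add: g_def)
  have gs: "g b summable_on UNIV" if "b \<ge> 0" for b
  proof -
    have "norm q ^ 2 < 1" using norm_square_less_one[OF q] by (simp add: norm_power)
    then have "summable (g b)" unfolding g_def using that by (intro summable_quadratic_power) auto
    then show ?thesis using g0[OF that] by (subst summable_on_UNIV_nonneg_real_iff) auto
  qed
  \<comment> \<open>One constant serves the denominators in both bases, since |q^2| <= |q|.\<close>
  have inv: "inverse (norm (qpoch a a' n)) \<le> D ^ n"
    if "a \<in> {q, q^2}" "a' \<in> {q, q^2}" for a a' n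
  proof -
    have "norm q * norm q \<le> norm q * 1" using q by (intro mult_left_mono) auto
    then have "norm a \<le> norm q" "norm a' < 1"
      using that q norm_square_less_one[OF q] by (auto simp: norm_mult power2_eq_square)
    then have "inverse (norm (qpoch a a' n)) \<le> inverse ((1 - norm q) ^ n)"
      using q by (intro le_imp_inverse_le norm_qpoch_ge) auto
    then show ?thesis by (simp add: D_def power_inverse)
  qed
  \<comment> \<open>Regrouping |w|^(j+2r) |y|^(j+2l) D^(j+l+r+s) by index gives the base
    \<open>a1\<close> for j, \<open>a2\<close> for l, \<open>a3\<close> for r and \<open>D\<close>
    for s.\<close>
  define a1 where "a1 = norm w * norm y * D"
  define a2 where "a2 = norm y ^ 2 * D"
  define a3 where "a3 = norm w ^ 2 * D"
  have pos: "a1 \<ge> 0" "a2 \<ge> 0" "a3 \<ge> 0" using D by (auto simp: a1_def a2_def a3_def)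
  have "(\<lambda>(r, s). g a3 r * g D s) summable_on UNIV"
    using pos D by (intro summable_on_product_nonneg gs g0)
  then have "(\<lambda>(l, t). g a2 l * (case t of (r, s) \<Rightarrow> g a3 r * g D s)) summable_on UNIV"
    using pos D by (intro summable_on_product_nonneg gs g0) (auto intro!: mult_nonneg_nonneg g0)
  then have "(\<lambda>(j, t). g a1 j * (case t of (l, t) \<Rightarrow> g a2 l * (case t of (r, s) \<Rightarrow> g a3 r * g D s)))
      summable_on UNIV" (is "?B summable_on UNIV")
    using pos D by (intro summable_on_product_nonneg gs g0) (auto intro!: mult_nonneg_nonneg g0)
  then show ?thesis
  proof (rule Infinite_Sum.abs_summable_on_comparison_test')
    fix t :: "nat \<times> nat \<times> nat \<times> nat"
    obtain j l r s where t: "t = (j, l, r, s)" by (cases t)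
    \<comment> \<open>The discarded cross terms, l^2, r^2 and s are nonnegative, so with |q| < 1 the
      smaller exponent \<open>E\<close> only enlarges the bound.\<close>
    define E where "E = 2 * (j choose 2) + 2 * (l choose 2) + 2 * (r choose 2) + 2 * (s choose 2)"
    have "norm (quad_term q w y j l r s) =
        norm w ^ (j + 2 * r) * norm y ^ (j + 2 * l)
       * norm q ^ (2 * ((j + l + r + s) choose 2) + l^2 + r^2 + s)
       * (inverse (norm (qpoch q q j)) * inverse (norm (qpoch (q^2) (q^2) l))
          * inverse (norm (qpoch (q^2) (q^2) r)) * inverse (norm (qpoch (q^2) (q^2) s)))"
      by (simp add: quad_term_def norm_mult norm_divide norm_power norm_inverse divide_inverse)
    also have "\<dots> \<le> norm w ^ (j + 2 * r) * norm y ^ (j + 2 * l) * norm q ^ E * (D ^ j * D ^ l * D ^ r * D ^ s)"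
      using q D
      by (intro mult_mono mult_nonneg_nonneg order.refl power_decreasing inv) (auto simp: E_def choose_two_add)
    also have "\<dots> = g a1 j * (g a2 l * (g a3 r * g D s))"
      by (simp add: g_def a1_def a2_def a3_def E_def power_add power_mult_distrib flip: power_mult)
    finally show "norm (case t of (j, l, r, s) \<Rightarrow> quad_term q w y j l r s) \<le> ?B t"
      by (simp add: t)
  qed
qed

text \<open>For T = j + l + r the sum over s is Euler's series in base p = q^2 at q p^T, that is,
  (q;p)_inf / (q;p)_T. As (q;p)_T (p;p)_T = (q;q)_(2T), inserting (p;p)_T above and below produces
  \<open>qtrinomial\<close>.\<close>

lemma quad_term_has_sum:
  fixes q w y :: complex
  assumes q: "norm q < 1"
  defines "m \<equiv> (\<lambda>j l. j + 2 * l)"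
  shows "((\<lambda>s. quad_term q w y j l r s) has_sum
      (qpoch_inf q (q^2) * (-1) ^ j * w ^ m j r * y ^ m j l * q ^ ((m j l choose 2) + (m j r choose 2))
        / qpoch q q (m j l + m j r) * qtrinomial q j l r)) UNIV"
proof -
  define p where "p = q^2"
  define T where "T = j + l + r"
  have p: "norm p < 1" unfolding p_def by (rule norm_square_less_one[OF q])
  have nzp: "qpoch p p n \<noteq> 0" and nzq: "qpoch q p n \<noteq> 0" for n
    by (intro qpoch_nonzero p q)+
  define K where "K = (-1) ^ j * w ^ m j r * y ^ m j l * q ^ (2 * (T choose 2) + l^2 + r^2)
      / (qpoch q q j * qpoch p p l * qpoch p p r)"
  have "((\<lambda>s. K * ((-1)^s * p ^ (s choose 2) / qpoch p p s * (q * p ^ T) ^ s)) has_sum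
      K * qpoch_inf (q * p ^ T) p) UNIV"
    by (intro has_sum_cmult_right euler_has_sum p)
  also have "(\<lambda>s. K * ((-1)^s * p ^ (s choose 2) / qpoch p p s * (q * p ^ T) ^ s))
      = (\<lambda>s. quad_term q w y j l r s)"
  proof
    fix s
    have "2 * ((j + l + r + s) choose 2) + l^2 + r^2 + s
        = (2 * (T choose 2) + l^2 + r^2) + 2 * (s choose 2) + s + 2 * T * s"
      by (simp add: T_def choose_two_add algebra_simps)
    then have "q ^ (2 * ((j + l + r + s) choose 2) + l^2 + r^2 + s)
        = q ^ (2 * (T choose 2) + l^2 + r^2) * (p ^ (s choose 2) * (q * p ^ T) ^ s)"
      by (simp only: p_def power_add power_mult_distrib mult_ac flip: power_mult)
    then show "K * ((-1)^s * p ^ (s choose 2) / qpoch p p s * (q * p ^ T) ^ s) = quad_term q w y j l r s"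
      unfolding quad_term_def
      by (simp only: K_def m_def p_def[symmetric] power_add[of "-1"]) simp
  qed
  also have "K * qpoch_inf (q * p ^ T) p =
      qpoch_inf q p * (-1) ^ j * w ^ m j r * y ^ m j l * q ^ ((m j l choose 2) + (m j r choose 2))
        / qpoch q q (m j l + m j r) * qtrinomial q j l r"
  proof -
    have "qpoch_inf (q * p ^ T) p = qpoch_inf q p / qpoch q p T"
      using qpoch_mult_qpoch_inf[OF p, of q T] nzq[of T] by (simp add: field_simps)
    moreover have "qpoch q q (m j l + m j r) = qpoch q p T * qpoch p p T"
    proof -
      have "m j l + m j r = 2 * T" by (simp add: m_def T_def)
      then show ?thesis by (simp only: qpoch_double p_def)
    qed
    \<comment> \<open>The surplus 2lr over the two binomial coefficients is precisely the power of q
      built into \<open>qtrinomial\<close>.\<close>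
    moreover have "2 * (T choose 2) + l^2 + r^2 = (m j l choose 2) + (m j r choose 2) + 2 * l * r"
    proof -
      have "(2 * n choose 2) + n = 2 * n^2" for n
        using twice_choose_two_add[of n] choose_two_add[of n n] by (simp add: mult_2 power2_eq_square)
      from this[of l] this[of r] show ?thesis
        using twice_choose_two_add[of l] twice_choose_two_add[of r]
        by (simp add: m_def T_def choose_two_add algebra_simps)
    qed
    ultimately show ?thesis
      using nzp[of T] by (simp add: K_def qtrinomial_def T_def[symmetric] p_def[symmetric] power_add mult_ac)
  qed
  finally show ?thesis by (simp only: p_def)
qed

text \<open>Along r + s = k the sum over r is the q-binomial expansion of (x^2 y^2; q^2)_k, read
  backwards.\<close>

lemma sum_quad_term:
  fixes q x y :: complex
  assumes q: "norm q < 1"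
  shows "(\<Sum>r\<le>k. quad_term q (x * y) y j l r (k - r)) =
     qpoch (x^2 * y^2) (q^2) k * x^j * y^(2*j + 2*l)
              / (qpoch q q j * qpoch (q^2) (q^2) k * qpoch (q^2) (q^2) l)
              * (-1)^(j + k) * q^((j + k + l) * (j + k + l - 1) + l^2 + k)"
proof -
  define p where "p = q^2"
  have p: "norm p < 1" unfolding p_def by (rule norm_square_less_one[OF q])
  have nzp: "qpoch p p n \<noteq> 0" for n by (intro qpoch_nonzero p)
  define C where "C = x^j * y^(2*j + 2*l) / (qpoch q q j * qpoch p p k * qpoch p p l)
     * (-1)^(j + k) * q^((j + k + l) * (j + k + l - 1) + l^2 + k)"
  have "quad_term q (x * y) y j l r (k - r) =
     C * (qpoch p p k / (qpoch p p r * qpoch p p (k - r)) * (-1)^r * p ^ (r choose 2) * (x^2 * y^2) ^ r)"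
    if "r \<le> k" for r
  proof -
    obtain s where k: "k = r + s" using \<open>r \<le> k\<close> le_Suc_ex by blast
    \<comment> \<open>Since r^2 = 2 (r choose 2) + r and r + s = k, the exponent r^2 + s supplies
      both k and the quadratic exponent of the q-binomial theorem.\<close>
    have "2 * ((j + l + r + s) choose 2) + l^2 + r^2 + s
        = ((j + k + l) * (j + k + l - 1) + l^2 + k) + 2 * (r choose 2)"
      unfolding twice_choose_two twice_choose_two_add[of r, symmetric]
      by (simp add: k add_ac)
    then have "q ^ (2 * ((j + l + r + s) choose 2) + l^2 + r^2 + s)
        = q ^ ((j + k + l) * (j + k + l - 1) + l^2 + k) * p ^ (r choose 2)"
      by (simp only: p_def power_add flip: power_mult)
    then have "quad_term q (x * y) y j l r s = (-1) ^ (j + s) * ((x * y) ^ (j + 2 * r) * y ^ (j + 2 * l))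
        * (q ^ ((j + k + l) * (j + k + l - 1) + l^2 + k) * p ^ (r choose 2))
        / (qpoch q q j * qpoch p p l * qpoch p p r * qpoch p p s)"
      by (simp only: quad_term_def p_def mult_ac)
    also have "(x * y) ^ (j + 2 * r) * y ^ (j + 2 * l) = x^j * y^(2*j + 2*l) * (x^2 * y^2) ^ r"
      by (simp add: power_add power_mult_distrib mult_2 power2_eq_square)
    also have "(-1::complex) ^ (j + s) = (-1) ^ (j + k) * (-1) ^ r"
      by (simp add: k power_add flip: power_mult_distrib)
    finally show ?thesis
      using nzp[of k] by (simp add: C_def mult_ac) (simp add: k)
  qed
  then have "(\<Sum>r\<le>k. quad_term q (x * y) y j l r (k - r)) = C * qpoch (x^2 * y^2) p k"
    unfolding qpoch_binomial[OF p, of "x^2 * y^2" k] sum_distrib_left by (intro sum.cong) auto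
  then show ?thesis by (simp add: C_def p_def)
qed

section \<open>Two groupings of the fourfold series\<close>

theorem theorem1p5:
  fixes q x y :: complex
  assumes "norm q < 1"
  shows "((\<lambda>(j::nat, k::nat, l::nat).
            qpoch (x^2 * y^2) (q^2) k * x^j * y^(2*j + 2*l)
              / (qpoch q q j * qpoch (q^2) (q^2) k * qpoch (q^2) (q^2) l)
              * (-1)^(j + k) * q^((j + k + l) * (j + k + l - 1) + l^2 + k))
          has_sum
          (qpoch_inf q (q^2) / 2
            * (qpoch_inf (x * y) q * qpoch_inf (- y) q
               + qpoch_inf (- (x * y)) q * qpoch_inf y q))) UNIV"
proof -
  define w where "w = x * y"
  define F where "F = (\<lambda>(j, l, r, s). quad_term q w y j l r s)"
  define Q where "Q = qpoch_inf q (q^2)"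
  define G where "G = (\<lambda>(j, l, r). Q * (-1) ^ j * w ^ (j + 2 * r) * y ^ (j + 2 * l)
     * q ^ ((j + 2 * l choose 2) + (j + 2 * r choose 2))
     / qpoch q q (j + 2 * l + (j + 2 * r)) * qtrinomial q j l r)"
  define e where "e = (\<lambda>z n. (-1)^n * q ^ (n choose 2) / qpoch q q n * z ^ n)"
  \<comment> \<open>The terms of y^m w^i on the right-hand side, from Euler's series for each of the
    four products.\<close>
  define H where "H = (\<lambda>(m, i). Q / 2 * (e w i * e (- y) m + e (- w) i * e y m))"
  define S where "S = infsum F UNIV"
  have S: "(F has_sum S) UNIV"
    unfolding S_def F_def
    by (rule has_sum_infsum[OF abs_summable_summable[OF abs_summable_quad_term[OF assms]]])
  have "((\<lambda>((j, l, r), s). F (j, l, r, s)) has_sum S) (SIGMA t:UNIV. UNIV) \<longleftrightarrow> (F has_sum S) UNIV"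
    by (rule has_sum_reindex_bij_witness[of _ "\<lambda>(j, l, r, s). ((j, l, r), s)" "\<lambda>((j, l, r), s). (j, l, r, s)"])
       auto
  with S have "((\<lambda>((j, l, r), s). F (j, l, r, s)) has_sum S) (SIGMA t:UNIV. UNIV)" by blast
  then have G: "(G has_sum S) UNIV"
  proof (rule has_sum_SigmaD, clarify)
    fix j l r :: nat
    show "((\<lambda>s. F (j, l, r, s)) has_sum G (j, l, r)) UNIV"
      using quad_term_has_sum[OF assms, of w y j l r] by (simp add: F_def G_def Q_def)
  qed
  \<comment> \<open>Each triple lies in exactly one fibre, so summing fibre by fibre collects the
    terms of each y^m w^i.\<close>
  have "((\<lambda>(_, t). G t) has_sum S) (SIGMA (m, i):UNIV. fibre m i) \<longleftrightarrow> (G has_sum S) UNIV"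
    by (rule has_sum_reindex_bij_witness[of _ "\<lambda>(j, l, r). ((j + 2 * l, j + 2 * r), (j, l, r))" "snd"])
       (auto simp: fibre_def)
  with G have "((\<lambda>(_, t). G t) has_sum S) (SIGMA (m, i):UNIV. fibre m i)" by blast
  then have "(H has_sum S) UNIV"
  proof (rule has_sum_SigmaD)
    fix t :: "nat \<times> nat"
    obtain m i where t: "t = (m, i)" by (cases t)
    have "(\<Sum>t\<in>fibre m i. G t) = (\<Sum>t\<in>fibre m i. Q * (-1) ^ i * w ^ i * y ^ m
     * q ^ ((m choose 2) + (i choose 2)) / qpoch q q (m + i) * (case t of (j, l, r) \<Rightarrow> qtrinomial q j l r))"
      by (intro sum.cong) (auto simp: fibre_def G_def power_add)
    also have "\<dots> = Q * (-1) ^ i * w ^ i * y ^ m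
     * q ^ ((m choose 2) + (i choose 2)) / qpoch q q (m + i) * (\<Sum>(j, l, r)\<in>fibre m i. qtrinomial q j l r)"
      by (simp add: sum_distrib_left)
    also have "\<dots> = H (m, i)"
    \<comment> \<open>The summands of \<open>H\<close> carry the signs (-1)^i and (-1)^m. For m + i
      even they agree, which cancels the 1/2; for m + i odd they are opposite and the fibre is
      empty.\<close>
    proof (cases "even (m + i)")
      case True
      have "(-1::complex) ^ i = (-1) ^ m" using True by (simp add: minus_one_power_iff)
      then show ?thesis
        unfolding sum_fibre_qtrinomial[OF assms True]
        using qpoch_nonzero[OF assms assms, of "m + i"]
        by (simp add: H_def e_def power_add power_minus[of w] power_minus[of y] mult_ac)
    next
      case False
      then have "fibre m i = {}" by (auto simp: fibre_def)
      moreover have "(-1::complex) ^ i = - ((-1) ^ m)" using False by (simp add: minus_one_power_iff)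
      ultimately show ?thesis
        by (simp add: H_def e_def power_minus[of w] power_minus[of y])
    qed
    finally have "(\<Sum>t\<in>fibre m i. G t) = H (m, i)" .
    then show "((\<lambda>u. case (t, u) of (_, u) \<Rightarrow> G u) has_sum H t) (case t of (m, i) \<Rightarrow> fibre m i)"
      by (simp add: t has_sum_finite_iff)
  qed
  moreover have "(H has_sum (Q / 2 * (qpoch_inf w q * qpoch_inf (- y) q + qpoch_inf (- w) q * qpoch_inf y q))) UNIV"
  proof -
    have e: "(e z has_sum qpoch_inf z q) UNIV" "(\<lambda>n. norm (e z n)) summable_on UNIV" for z
      unfolding e_def by (rule euler_has_sum[OF assms], rule abs_summable_euler[OF assms])
    have "((\<lambda>(m, i). e z m * e z' i) has_sum qpoch_inf z q * qpoch_inf z' q) UNIV" for z z'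
      by (rule has_sum_product_abs_summable[OF e(1) e(1) e(2) e(2)])
    from has_sum_cmult_right[OF has_sum_add[OF this[of "- y" w] this[of y "- w"]], of "Q / 2"]
    show ?thesis by (simp add: H_def case_prod_unfold mult_ac)
  qed
  ultimately have S_eq: "S = Q / 2 * (qpoch_inf w q * qpoch_inf (- y) q + qpoch_inf (- w) q * qpoch_inf y q)"
    by (rule has_sum_unique)
  \<comment> \<open>The second grouping, by k = r + s with r <= k, recovers the original triple
    series with the same sum \<open>S\<close>.\<close>
  have "((\<lambda>((j, k, l), r). quad_term q w y j l r (k - r)) has_sum S) (SIGMA (j, k, l):UNIV. {..k})
      \<longleftrightarrow> (F has_sum S) UNIV"
    by (rule has_sum_reindex_bij_witness[of _ "\<lambda>(j, l, r, s). ((j, r + s, l), r)" "\<lambda>((j, k, l), r). (j, l, r, k - r)"])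
       (auto simp: F_def)
  with S have "((\<lambda>((j, k, l), r). quad_term q w y j l r (k - r)) has_sum S) (SIGMA (j, k, l):UNIV. {..k})"
    by blast
  then have "((\<lambda>(j, k, l). \<Sum>r\<le>k. quad_term q w y j l r (k - r)) has_sum S) UNIV"
    by (rule has_sum_SigmaD) (auto simp: has_sum_finite_iff)
  then show ?thesis
    unfolding w_def sum_quad_term[OF assms] S_eq Q_def .
qed

end
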